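(* Let $q$ be an odd prime power and let $G=GT_2(\mathbf{F}_q)$ be the group of invertible upper triangular $2\times2$ matrices over $\mathbf{F}_q$. Then $$cp_2(G)=\frac{1}{q-1},\qquad cp_3(G)=\frac{q^2-q+2}{q^4-2q^3+q^2},$$ $$cp_4(G)=\frac{q^2-2q+4}{q^5-3q^4+3q^3-q^2},\qquad cp_5(G)=\frac{q^4-3q^3+7q^2-3q+2}{q^8-4q^7+6q^6-4q^5+q^4}.$$
   Context: $\mathbf{F}_q$ is the finite field with $q$ elements, $q$ odd. For a finite group $G$ and $k\ge 2$, the commuting probability $cp_k(G)$ is the probability that a uniformly random $k$-tuple of elements of $G$ consists of pairwise commuting elements, i.e. $cp_k(G)=|\{(g_1,\dots,g_k)\in G^k: g_ig_j=g_jg_i\text{ for all }i,j\}|/|G|^k$. *)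

theory Defs
  imports
    "HOL-Library.Cardinality"
    "HOL-Number_Theory.Prime_Powers"
    "HOL-Algebra.Coset"
    "Jordan_Normal_Form.Matrix"
begin

definition commuting_tuples :: "nat \<Rightarrow> ('a, 'b) monoid_scheme \<Rightarrow> (nat \<Rightarrow> 'a) set" where
  "commuting_tuples k G =
     {g \<in> {..<k} \<rightarrow>\<^sub>E carrier G. \<forall>i<k. \<forall>j<k. g i \<otimes>\<^bsub>G\<^esub> g j = g j \<otimes>\<^bsub>G\<^esub> g i}"

definition cp :: "nat \<Rightarrow> ('a, 'b) monoid_scheme \<Rightarrow> real" where
  "cp k G = real (card (commuting_tuples k G)) / real (order G) ^ k"

(* Matrix inverses of upper triangular matrices are upper triangular, so invertibility
   may be taken in the full matrix ring. *)
definition GT :: "nat \<Rightarrow> 'a :: field mat monoid" where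
  "GT n = \<lparr>carrier = {A \<in> carrier_mat n n. upper_triangular A \<and> invertible_mat A},
           mult = (*), one = 1\<^sub>m n\<rparr>"

end

theory Submission
  imports Defs
begin

text \<open>
  The matrix with rows \<open>(a, b)\<close> and \<open>(0, d)\<close> commutes with the one with rows \<open>(a', b')\<close> and
  \<open>(0, d')\<close> iff \<open>(a - d) * b' = (a' - d') * b\<close>, that is, iff the vectors \<open>(a - d, b)\<close> and
  \<open>(a' - d', b')\<close> are parallel. So two matrices commute iff their vectors lie on a common line
  through the origin of the plane over the field. The \<open>q + 1\<close> lines yield \<open>q + 1\<close> sets of
  matrices that cover the group, and any two of them meet exactly in the scalar matrices \<open>Z\<close>,
  whose vector is zero.

  Commuting is therefore transitive through any matrix outside \<open>Z\<close>, so a pairwise commuting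
  tuple lies entirely within one of these sets (\<open>commuting_tuples_eq_UN\<close>), and this set is
  unique unless the whole tuple is scalar. Counting \<open>k\<close>-tuples
  (\<open>card_commuting_tuples\<close>) leaves only the sizes of the sets: \<open>q * (q - 1)\<close> for the line of
  matrices with equal diagonal entries, \<open>(q - 1)^2\<close> for each of the \<open>q\<close> other lines, and
  \<open>q - 1\<close> for \<open>Z\<close>. The result is the closed form \<open>cp_GT2\<close> for every \<open>k\<close>; the claims are
  its values at \<open>k = 2, 3, 4, 5\<close>, reduced as rational functions of \<open>q\<close>.
\<close>

section \<open>Commuting tuples in a union of sets with a common intersection\<close>

text \<open>
  If some entry lies outside \<open>Z\<close>, then it belongs to a single \<open>L i\<close>, and every other
  entry, having to share a set with it, belongs to the same \<open>L i\<close>. The index type being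
  inhabited takes care of tuples within \<open>Z\<close>.
\<close>

lemma commuting_tuples_eq_UN:
  fixes L :: "'i \<Rightarrow> 'a set"
  assumes sub: "\<And>i. L i \<subseteq> carrier G"
    and inter: "\<And>i j. i \<noteq> j \<Longrightarrow> L i \<inter> L j = Z"
    and Z: "\<And>i. Z \<subseteq> L i"
    and comm: "\<And>x y. x \<in> carrier G \<Longrightarrow> y \<in> carrier G \<Longrightarrow>
                 x \<otimes>\<^bsub>G\<^esub> y = y \<otimes>\<^bsub>G\<^esub> x \<longleftrightarrow> (\<exists>i. x \<in> L i \<and> y \<in> L i)"
  shows "commuting_tuples k G = (\<Union>i. {..<k} \<rightarrow>\<^sub>E L i)"
proof (intro equalityI subsetI)
  fix g assume g: "g \<in> commuting_tuples k G"
  then have mem: "g \<in> {..<k} \<rightarrow>\<^sub>E carrier G"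
    and share: "\<And>m n. m < k \<Longrightarrow> n < k \<Longrightarrow> \<exists>i. g m \<in> L i \<and> g n \<in> L i"
    using comm by (auto simp: commuting_tuples_def PiE_iff)
  have "\<exists>i. \<forall>n<k. g n \<in> L i"
  proof (cases "\<forall>n<k. g n \<in> Z")
    case True
    then show ?thesis using Z by blast
  next
    case False
    then obtain m where m: "m < k" "g m \<notin> Z" by blast
    then obtain i where i: "g m \<in> L i" using share[OF m(1) m(1)] by blast
    have "g n \<in> L i" if n: "n < k" for n
    proof -
      obtain j where j: "g m \<in> L j" "g n \<in> L j" using share[OF m(1) n] by blast
      with i m have "i = j" using inter[of i j] by blast
      with j show ?thesis by simp
    qed
    then show ?thesis by blast
  qed
  with mem show "g \<in> (\<Union>i. {..<k} \<rightarrow>\<^sub>E L i)" by (auto simp: PiE_iff)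
next
  fix g assume "g \<in> (\<Union>i. {..<k} \<rightarrow>\<^sub>E L i)"
  then obtain i where i: "g \<in> {..<k} \<rightarrow>\<^sub>E L i" by blast
  then have mem: "g \<in> {..<k} \<rightarrow>\<^sub>E carrier G" using sub by (auto simp: PiE_iff)
  have "g m \<otimes>\<^bsub>G\<^esub> g n = g n \<otimes>\<^bsub>G\<^esub> g m" if "m < k" "n < k" for m n
  proof -
    have "g m \<in> L i" "g n \<in> L i" using i that by (auto simp: PiE_iff)
    then show ?thesis using sub comm by blast
  qed
  with mem show "g \<in> commuting_tuples k G" by (simp add: commuting_tuples_def)
qed

text \<open>
  The tuples within \<open>Z\<close> are common to all the sets of tuples; the remaining tuples of \<open>L i\<close>
  are disjoint for distinct \<open>i\<close>. Hence \<open>Z\<close> is counted once, and then subtracted from each \<open>L i\<close>.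
\<close>

lemma card_commuting_tuples:
  fixes L :: "'i::finite \<Rightarrow> 'a set"
  assumes fin: "finite (carrier G)"
    and sub: "\<And>i. L i \<subseteq> carrier G"
    and inter: "\<And>i j. i \<noteq> j \<Longrightarrow> L i \<inter> L j = Z"
    and Z: "\<And>i. Z \<subseteq> L i"
    and comm: "\<And>x y. x \<in> carrier G \<Longrightarrow> y \<in> carrier G \<Longrightarrow>
                 x \<otimes>\<^bsub>G\<^esub> y = y \<otimes>\<^bsub>G\<^esub> x \<longleftrightarrow> (\<exists>i. x \<in> L i \<and> y \<in> L i)"
  shows "real (card (commuting_tuples k G))
           = real (card Z) ^ k + (\<Sum>i\<in>UNIV. real (card (L i)) ^ k - real (card Z) ^ k)"
proof -
  let ?T = "\<lambda>A. {..<k} \<rightarrow>\<^sub>E A :: (nat \<Rightarrow> 'a) set"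
  have finL: "finite (L i)" for i using fin sub finite_subset by blast
  then have finZ: "finite Z" using Z finite_subset by blast
  have finT: "finite (?T A)" if "finite A" for A using that by (intro finite_PiE) auto
  have card_T: "card (?T A) = card A ^ k" for A by (simp add: card_PiE)
  have TZ: "?T Z \<subseteq> ?T (L i)" for i using Z by (intro PiE_mono) auto
  have disj: "(?T (L i) - ?T Z) \<inter> (?T (L j) - ?T Z) = {}" if "i \<noteq> j" for i j
  proof -
    have "?T (L i) \<inter> ?T (L j) = ?T Z"
      by (simp add: PiE_Int inter[OF that])
    then show ?thesis by auto
  qed
  have card_diff: "real (card (?T (L i) - ?T Z)) = real (card (L i)) ^ k - real (card Z) ^ k" for i
  proof -
    have "card (?T (L i) - ?T Z) = card (?T (L i)) - card (?T Z)"
      using finZ finT TZ by (intro card_Diff_subset) auto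
    moreover have "card (?T Z) \<le> card (?T (L i))"
      using finL finT TZ by (intro card_mono) auto
    ultimately show ?thesis by (simp add: card_T of_nat_diff)
  qed
  have "commuting_tuples k G = ?T Z \<union> (\<Union>i. ?T (L i) - ?T Z)"
  proof -
    have "commuting_tuples k G = (\<Union>i. ?T (L i))"
      by (rule commuting_tuples_eq_UN[OF sub inter Z comm])
    also have "\<dots> = ?T Z \<union> (\<Union>i. ?T (L i) - ?T Z)"
      using TZ by blast
    finally show ?thesis .
  qed
  also have "card \<dots> = card (?T Z) + card (\<Union>i. ?T (L i) - ?T Z)"
    using finL finZ finT by (intro card_Un_disjoint) auto
  also have "card (\<Union>i. ?T (L i) - ?T Z) = (\<Sum>i\<in>UNIV. card (?T (L i) - ?T Z))"
    using finL finT disj by (intro card_UN_disjoint) auto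
  also have "card (?T Z) = card Z ^ k" by (rule card_T)
  finally show ?thesis by (simp add: card_diff)
qed

section \<open>Upper triangular matrices of size two\<close>

definition utri :: "'a::field \<Rightarrow> 'a \<Rightarrow> 'a \<Rightarrow> 'a mat" where
  "utri a b d = mat_of_rows_list 2 [[a, b], [0, d]]"

lemma dim_utri [simp]: "dim_row (utri a b d) = 2" "dim_col (utri a b d) = 2"
  by (simp_all add: utri_def mat_of_rows_list_def)

lemma utri_carrier [simp]: "utri a b d \<in> carrier_mat 2 2"
  by (rule carrier_matI) simp_all

lemma index_utri [simp]:
  "utri a b d $$ (0, 0) = a" "utri a b d $$ (0, Suc 0) = b"
  "utri a b d $$ (Suc 0, 0) = 0" "utri a b d $$ (Suc 0, Suc 0) = d"
  by (simp_all add: utri_def mat_of_rows_list_def)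

lemma utri_eq_iff [simp]: "utri a b d = utri a' b' d' \<longleftrightarrow> a = a' \<and> b = b' \<and> d = d'"
  by (metis index_utri)

lemma mat2_eqI:
  assumes A: "A \<in> carrier_mat 2 2" and B: "B \<in> carrier_mat 2 2"
    and eq: "A $$ (0, 0) = B $$ (0, 0)" "A $$ (0, Suc 0) = B $$ (0, Suc 0)"
      "A $$ (Suc 0, 0) = B $$ (Suc 0, 0)" "A $$ (Suc 0, Suc 0) = B $$ (Suc 0, Suc 0)"
  shows "A = B"
proof (rule eq_matI)
  fix i j assume "i < dim_row B" "j < dim_col B"
  then have "i = 0 \<or> i = Suc 0" "j = 0 \<or> j = Suc 0"
    using carrier_matD[OF B] by (simp_all add: less_2_cases_iff)
  then show "A $$ (i, j) = B $$ (i, j)"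
    using eq by (elim disjE) simp_all
qed (simp_all add: carrier_matD[OF A] carrier_matD[OF B])

lemma index_mult_mat2:
  assumes "A \<in> carrier_mat 2 2" "B \<in> carrier_mat 2 2" "i < 2" "j < 2"
  shows "(A * B) $$ (i, j) = A $$ (i, 0) * B $$ (0, j) + A $$ (i, Suc 0) * B $$ (Suc 0, j)"
proof -
  have "{0..<2} = {0, Suc 0}" by auto
  with assms show ?thesis by (simp add: scalar_prod_def)
qed

lemma utri_mult: "utri a b d * utri a' b' d' = utri (a * a') (a * b' + b * d') (d * d')"
  by (rule mat2_eqI) (simp_all add: index_mult_mat2 mult_carrier_mat[of _ 2 2] del: index_mult_mat)

lemma utri_one: "1\<^sub>m 2 = utri 1 0 1"
  by (rule mat2_eqI) simp_all

lemma invertible_utri_iff: "invertible_mat (utri a b d) \<longleftrightarrow> a \<noteq> 0 \<and> d \<noteq> 0"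
proof
  assume "invertible_mat (utri a b d)"
  then obtain B where B: "utri a b d * B = 1\<^sub>m 2" "B * utri a b d = 1\<^sub>m (dim_row B)"
    by (auto simp: invertible_mat_def inverts_mat_def)
  have dims: "dim_row B = 2" "dim_col B = 2"
    using arg_cong[OF B(1), of dim_col] arg_cong[OF B(2), of dim_col] by simp_all
  then have carr: "B \<in> carrier_mat 2 2" by (rule carrier_matI)
  \<comment> \<open>The zero below the diagonal reduces these two entries to a single product each.\<close>
  have "(B * utri a b d) $$ (0, 0) = B $$ (0, 0) * a"
    "(utri a b d * B) $$ (Suc 0, Suc 0) = d * B $$ (Suc 0, Suc 0)"
    using carr by (simp_all add: index_mult_mat2 del: index_mult_mat)
  with B dims have "B $$ (0, 0) * a = 1" "d * B $$ (Suc 0, Suc 0) = 1" by simp_all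
  then show "a \<noteq> 0 \<and> d \<noteq> 0" by auto
next
  assume ad: "a \<noteq> 0 \<and> d \<noteq> 0"
  let ?B = "utri (1 / a) (- b / (a * d)) (1 / d)"
  have "utri a b d * ?B = 1\<^sub>m 2" "?B * utri a b d = 1\<^sub>m 2"
    using ad by (simp_all add: utri_mult utri_one)
  then have "inverts_mat (utri a b d) ?B" "inverts_mat ?B (utri a b d)"
    by (simp_all add: inverts_mat_def)
  then show "invertible_mat (utri a b d)"
    unfolding invertible_mat_def by auto
qed

lemma carrier_GT2:
  "carrier (GT 2 :: 'a::field mat monoid) = {utri a b d | a b d. a \<noteq> 0 \<and> d \<noteq> 0}" (is "?L = ?R")
proof (intro equalityI subsetI)
  fix A :: "'a mat" assume "A \<in> ?L"
  then have A: "A \<in> carrier_mat 2 2" "upper_triangular A" "invertible_mat A"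
    by (auto simp: GT_def)
  have "A = utri (A $$ (0, 0)) (A $$ (0, Suc 0)) (A $$ (Suc 0, Suc 0))"
    by (rule mat2_eqI) (use A in auto)
  with A(3) show "A \<in> ?R" by (metis (mono_tags, lifting) invertible_utri_iff mem_Collect_eq)
next
  fix A :: "'a mat" assume "A \<in> ?R"
  then show "A \<in> ?L"
    by (auto simp: GT_def invertible_utri_iff upper_triangular_def less_2_cases_iff)
qed

lemma carrier_GT2_image:
  "carrier (GT 2 :: 'a::field mat monoid)
     = (\<lambda>(a, b, d). utri a b d) ` ((UNIV - {0}) \<times> UNIV \<times> (UNIV - {0}))"
  by (auto simp: carrier_GT2 image_iff)

lemma finite_carrier_GT2: "finite (carrier (GT 2 :: 'a::{field, finite} mat monoid))"
  by (simp add: carrier_GT2_image)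

lemma order_GT2:
  "order (GT 2 :: 'a::{field, finite} mat monoid) = (CARD('a) - 1) * (CARD('a) * (CARD('a) - 1))"
  unfolding order_def carrier_GT2_image
  by (subst card_image) (auto simp: inj_on_def card_Diff_singleton)

section \<open>The lines and their sizes\<close>

text \<open>
  \<open>None\<close> is the vertical line, of matrices with equal diagonal entries; \<open>Some t\<close> is the line
  of slope \<open>t\<close> in the plane of the vectors \<open>(a - d, b)\<close>.
\<close>

fun line :: "'a::field option \<Rightarrow> 'a mat set" where
  "line None = (\<lambda>(a, b). utri a b a) ` ((UNIV - {0}) \<times> UNIV)"
| "line (Some t) = (\<lambda>(a, d). utri a (t * (a - d)) d) ` ((UNIV - {0}) \<times> (UNIV - {0}))"

definition scalars :: "'a::field mat set" where
  "scalars = (\<lambda>a. utri a 0 a) ` (UNIV - {0})"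

lemma utri_in_line [simp]:
  "utri a b d \<in> line None \<longleftrightarrow> a \<noteq> 0 \<and> a = d"
  "utri a b d \<in> line (Some t) \<longleftrightarrow> a \<noteq> 0 \<and> d \<noteq> 0 \<and> b = t * (a - d)"
  by (auto simp: image_iff)

declare line.simps [simp del]

lemma utri_in_scalars [simp]: "utri a b d \<in> scalars \<longleftrightarrow> a \<noteq> 0 \<and> b = 0 \<and> a = d"
  by (auto simp: scalars_def)

lemma line_subset_GT2: "line i \<subseteq> carrier (GT 2)"
  by (cases i) (auto simp: carrier_GT2 line.simps)

lemma scalars_subset_line: "scalars \<subseteq> line i"
  by (cases i) (auto simp: scalars_def)

lemma line_Int_line:
  assumes "i \<noteq> j"
  shows "line i \<inter> line j = scalars"
proof
  show "line i \<inter> line j \<subseteq> scalars"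
  proof
    fix A assume A: "A \<in> line i \<inter> line j"
    then obtain a b d where "A = utri a b d"
      using line_subset_GT2[of i] by (auto simp: carrier_GT2)
    with A assms show "A \<in> scalars" by (cases i; cases j) auto
  qed
qed (use scalars_subset_line in blast)

text \<open>
  Equating the off-diagonal entries of the two products says that the vectors \<open>(a - d, b)\<close> and
  \<open>(a' - d', b')\<close> are parallel.
\<close>

lemma utri_commute_iff:
  "utri a b d * utri a' b' d' = utri a' b' d' * utri a b d \<longleftrightarrow> (a - d) * b' = (a' - d') * b"
  by (auto simp: utri_mult algebra_simps)

lemma GT2_commute_iff:
  assumes "x \<in> carrier (GT 2)" "y \<in> carrier (GT 2)"
  shows "x \<otimes>\<^bsub>GT 2\<^esub> y = y \<otimes>\<^bsub>GT 2\<^esub> x \<longleftrightarrow> (\<exists>i. x \<in> line i \<and> y \<in> line i)"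
proof -
  obtain a b d where x: "x = utri a b d" "a \<noteq> 0" "d \<noteq> 0"
    using assms(1) by (auto simp: carrier_GT2)
  obtain a' b' d' where y: "y = utri a' b' d'" "a' \<noteq> 0" "d' \<noteq> 0"
    using assms(2) by (auto simp: carrier_GT2)
  have "x \<otimes>\<^bsub>GT 2\<^esub> y = y \<otimes>\<^bsub>GT 2\<^esub> x \<longleftrightarrow> (a - d) * b' = (a' - d') * b"
    by (simp add: GT_def x y utri_commute_iff)
  also have "\<dots> \<longleftrightarrow> (\<exists>i. x \<in> line i \<and> y \<in> line i)"
  proof
    assume par: "(a - d) * b' = (a' - d') * b"
    \<comment> \<open>A nonzero first coordinate of either vector determines the slope.\<close>
    consider "a = d" "a' = d'" | "a \<noteq> d" | "a = d" "a' \<noteq> d'" by blast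
    then show "\<exists>i. x \<in> line i \<and> y \<in> line i"
    proof cases
      case 1
      then show ?thesis using x y by (intro exI[of _ None]) auto
    next
      case 2
      then have "b' = b / (a - d) * (a' - d')"
        using par by (simp add: nonzero_eq_divide_eq mult.commute)
      with 2 show ?thesis using x y by (intro exI[of _ "Some (b / (a - d))"]) simp
    next
      case 3
      then show ?thesis using x y par
        by (intro exI[of _ "Some (b' / (a' - d'))"]) simp
    qed
  next
    assume "\<exists>i. x \<in> line i \<and> y \<in> line i"
    then obtain i where "x \<in> line i" "y \<in> line i" by blast
    then show "(a - d) * b' = (a' - d') * b"
      using x y by (cases i) auto
  qed
  finally show ?thesis .
qed

lemma card_scalars: "card (scalars :: 'a::{field, finite} mat set) = CARD('a) - 1"
  unfolding scalars_def by (subst card_image) (auto simp: inj_on_def card_Diff_singleton)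

lemma card_line:
  "card (line None :: 'a::{field, finite} mat set) = (CARD('a) - 1) * CARD('a)"
  "card (line (Some t) :: 'a mat set) = (CARD('a) - 1) * (CARD('a) - 1)"
  unfolding line.simps
  by (subst card_image; auto simp: inj_on_def card_Diff_singleton)+

section \<open>The commuting probabilities\<close>

lemma CARD_field_ge_2: "CARD('a::{field, finite}) \<ge> 2"
proof -
  have "card {0, 1 :: 'a} \<le> CARD('a)" by (intro card_mono) auto
  then show ?thesis by simp
qed

lemma card_commuting_tuples_GT2:
  fixes q :: real
  assumes "q = real CARD('a::{field, finite})"
  shows "real (card (commuting_tuples k (GT 2 :: 'a mat monoid)))
           = (q - 1) ^ k * (q ^ k + q * (q - 1) ^ k - q)"
proof -
  have q1: "real (CARD('a) - 1) = q - 1"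
    using assms CARD_field_ge_2[where 'a='a] by (simp add: of_nat_diff)
  have "real (card (commuting_tuples k (GT 2 :: 'a mat monoid)))
      = real (card (scalars :: 'a mat set)) ^ k
        + (\<Sum>i\<in>UNIV. real (card (line (i :: 'a option))) ^ k
                      - real (card (scalars :: 'a mat set)) ^ k)"
    by (rule card_commuting_tuples)
      (use finite_carrier_GT2 line_subset_GT2 line_Int_line scalars_subset_line GT2_commute_iff
        in blast)+
  also have "\<dots> = (q - 1) ^ k + (((q - 1) * q) ^ k - (q - 1) ^ k
                    + q * (((q - 1) * (q - 1)) ^ k - (q - 1) ^ k))"
    using assms by (simp add: UNIV_option_conv sum.reindex card_line card_scalars q1)
  also have "\<dots> = (q - 1) ^ k * (q ^ k + q * (q - 1) ^ k - q)"
    unfolding power_mult_distrib by (simp add: algebra_simps)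
  finally show ?thesis .
qed

lemma cp_GT2:
  fixes q :: real
  assumes "q = real CARD('a::{field, finite})"
  shows "cp k (GT 2 :: 'a mat monoid) = (q ^ k + q * (q - 1) ^ k - q) / (q * (q - 1)) ^ k"
proof -
  have q1: "real (CARD('a) - 1) = q - 1" and "q - 1 \<noteq> 0"
    using assms CARD_field_ge_2[where 'a='a] by (auto simp: of_nat_diff)
  moreover have "real (order (GT 2 :: 'a mat monoid)) = (q - 1) * (q * (q - 1))"
    using assms by (simp add: order_GT2 q1)
  ultimately show ?thesis
    by (simp add: cp_def card_commuting_tuples_GT2[OF assms] power_mult_distrib)
qed

theorem mainTheorem5:
  fixes q :: nat and G :: "'a :: {field, finite} mat monoid"
  assumes "primepow q" and "odd q" and "CARD('a) = q"
    and "G = GT 2"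
  shows "cp 2 G = 1 / (real q - 1) \<and>
    cp 3 G = (real q ^ 2 - real q + 2) / (real q ^ 4 - 2 * real q ^ 3 + real q ^ 2) \<and>
    cp 4 G = (real q ^ 2 - 2 * real q + 4)
           / (real q ^ 5 - 3 * real q ^ 4 + 3 * real q ^ 3 - real q ^ 2) \<and>
    cp 5 G = (real q ^ 4 - 3 * real q ^ 3 + 7 * real q ^ 2 - 3 * real q + 2)
           / (real q ^ 8 - 4 * real q ^ 7 + 6 * real q ^ 6 - 4 * real q ^ 5 + real q ^ 4)"
proof -
  define x where "x = real q"
  have cp: "cp k G = (x ^ k + x * (x - 1) ^ k - x) / (x * (x - 1)) ^ k" for k
    using assms(3,4) by (simp add: x_def cp_GT2)
  have nz: "x \<noteq> 0" "x - 1 \<noteq> 0"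
    using assms(3) CARD_field_ge_2[where 'a='a] by (auto simp: x_def)
  \<comment> \<open>Naming the common factor \<open>c\<close> leaves only polynomial identities in \<open>x\<close>.\<close>
  have reduce: "cp k G = n / e"
    if "x ^ k + x * (x - 1) ^ k - x = c * n" "(x * (x - 1)) ^ k = c * e" "c \<noteq> 0" for k n e c
    using that by (simp add: cp)
  have "cp 2 G = 1 / (x - 1)"
    by (rule reduce[where c = "x ^ 2 * (x - 1)"])
      (use nz in \<open>simp_all add: power_numeral_reduce algebra_simps\<close>)
  moreover have "cp 3 G = (x ^ 2 - x + 2) / (x ^ 4 - 2 * x ^ 3 + x ^ 2)"
    by (rule reduce[where c = "x * (x - 1)"])
      (use nz in \<open>simp_all add: power_numeral_reduce algebra_simps\<close>)
  moreover have "cp 4 G = (x ^ 2 - 2 * x + 4) / (x ^ 5 - 3 * x ^ 4 + 3 * x ^ 3 - x ^ 2)"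
    by (rule reduce[where c = "x ^ 2 * (x - 1)"])
      (use nz in \<open>simp_all add: power_numeral_reduce algebra_simps\<close>)
  moreover have "cp 5 G = (x ^ 4 - 3 * x ^ 3 + 7 * x ^ 2 - 3 * x + 2)
      / (x ^ 8 - 4 * x ^ 7 + 6 * x ^ 6 - 4 * x ^ 5 + x ^ 4)"
    by (rule reduce[where c = "x * (x - 1)"])
      (use nz in \<open>simp_all add: power_numeral_reduce algebra_simps\<close>)
  ultimately show ?thesis by (simp add: x_def)
qed

end
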